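(* Let $f:X\to Y$ and assume there exists $\bar \xi \in C^*\setminus \{0\}$ such that $f$ is $C$-bounded from below by $\bar \xi$ and the function $x\mapsto\langle \bar \xi , f(x)\rangle$ is lower semicontinuous on $X$. Then there exists a sequence of functions $f_n : X \to Y$ converging to $f$ uniformly on bounded subsets of $X$, such that, for every $n$, $\mathrm{Eff}(X, f_n) \neq \emptyset$ and the problem $(X, f_n)$ is DH-well-posed at some $\bar x_n\in \mathrm{Eff}(X, f_n)$.
   Context: $X$ and $Y$ are (real) Banach spaces, and $C \subseteq Y$ is a closed, convex, pointed cone with nonempty interior. $Y^*$ is the topological dual of $Y$, and $C^*=\{\xi\in Y^*:\langle \xi,c\rangle\ge 0\ \forall c\in C\}$. For $f:X\to Y$, the problem $(X,f)$ is the vector optimization problem $\min f(x)$, $x\in X$, with respect to the order $y_1\le_C y_2 \iff y_2-y_1\in C$. $f:X\to Y$ is $C$-bounded from below by $\xi\in C^*\setminus\{0\}$ when $\inf_{x\in X}\langle \xi,f(x)\rangle>-\infty$. Efficient solutions: $\mathrm{Eff}(X,f)$ is the set of all $\bar x\in X$ such that $(f(X)-f(\bar x))\cap(-C)=\{0\}$. DH-well-posedness: the problem $(X,f)$ is DH-well-posed at $\bar x\in \mathrm{Eff}(X,f)$ if $\inf_{\alpha>0}\mathrm{diam}\, L_f^C(f(\bar x)+\alpha c)=0$ for every $c\in C$, where $L_f^C(y)=\{x\in X: f(x)\in y-C\}$ and $\mathrm{diam}\,A=\sup\{\|x-y\|: x,y\in A\}$. *)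

theory Defs
  imports "HOL-Analysis.Analysis"
begin

definition dual_cone :: "'b::real_normed_vector set \<Rightarrow> ('b \<Rightarrow>\<^sub>L real) set" where
  "dual_cone C = {\<xi>. \<forall>c\<in>C. blinfun_apply \<xi> c \<ge> 0}"

definition bounded_below_by :: "('b::real_normed_vector \<Rightarrow>\<^sub>L real) \<Rightarrow> ('a \<Rightarrow> 'b) \<Rightarrow> bool" where
  "bounded_below_by \<xi> f \<longleftrightarrow> (INF x. ereal (blinfun_apply \<xi> (f x))) > -\<infinity>"

definition lower_semicontinuous :: "('a::topological_space \<Rightarrow> real) \<Rightarrow> bool" where
  "lower_semicontinuous g \<longleftrightarrow> (\<forall>x. \<forall>a<g x. \<forall>\<^sub>F z in nhds x. a < g z)"

text \<open>In the following notions the feasible set is the whole space, i.e. the type \<open>'a\<close>.\<close>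

definition efficient :: "'b::real_vector set \<Rightarrow> ('a \<Rightarrow> 'b) \<Rightarrow> 'a set" where
  "efficient C f = {x. (\<lambda>y. y - f x) ` range f \<inter> uminus ` C = {0}}"

definition level_set :: "'b::real_vector set \<Rightarrow> ('a \<Rightarrow> 'b) \<Rightarrow> 'b \<Rightarrow> 'a set" where
  "level_set C f y = {x. f x \<in> (\<lambda>c. y - c) ` C}"

text \<open>The real-valued \<^const>\<open>diameter\<close> is meaningless on unbounded sets, and level sets may be
  unbounded; hence an extended diameter, which is \<open>\<infinity>\<close> there.\<close>

definition ediameter :: "'a::real_normed_vector set \<Rightarrow> ennreal" where
  "ediameter A = (SUP (x, y)\<in>A \<times> A. ennreal (norm (x - y)))"

text \<open>Only meant for points \<open>x\<close> that are efficient for \<open>f\<close>; efficiency is not part of the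
  definition.\<close>

definition DH_well_posed_at ::
    "'b::real_vector set \<Rightarrow> ('a::real_normed_vector \<Rightarrow> 'b) \<Rightarrow> 'a \<Rightarrow> bool" where
  "DH_well_posed_at C f x \<longleftrightarrow>
    (\<forall>c\<in>C. (INF \<alpha>\<in>{0::real<..}. ediameter (level_set C f (f x + \<alpha> *\<^sub>R c))) = 0)"

end

theory Submission
  imports Defs
begin

text \<open>
  The problem is reduced to a scalar one. Let \<open>g x = \<xi> (f x)\<close>. Every \<open>\<xi> \<in> C\<^sup>*\<close> is monotone for the order
  of \<open>C\<close>, so if \<open>\<xi> \<circ> h\<close> grows at least linearly away from a point \<open>a\<close>, then \<open>h x \<le>\<^sub>C h a + \<alpha> c\<close> forces
  \<open>x\<close> to lie in a ball around \<open>a\<close> with radius proportional to \<open>\<alpha>\<close>. Hence such a sharp minimum \<open>a\<close> of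
  \<open>\<xi> \<circ> h\<close> is an efficient point at which \<open>h\<close> is DH-well-posed (lemmas
  \<open>sharp_minimum_imp_efficient\<close> and \<open>sharp_minimum_imp_DH_well_posed\<close>).

  It remains to create a sharp minimum by a small perturbation of \<open>f\<close> in one fixed direction \<open>e\<close> with
  \<open>\<xi> e = 1\<close>, which changes \<open>g\<close> by the scalar amount of the perturbation. Take a \<open>\<delta>\<close>-minimizer \<open>a\<close> of
  \<open>g\<close>. Lowering the value at \<open>a\<close> by \<open>\<delta>\<close> turns \<open>a\<close> into a minimizer, and adding the cone-shaped
  function \<open>\<epsilon> \<parallel>x - a\<parallel>\<close> makes this minimum sharp. When \<open>\<delta>\<close> tends to zero, the near-minimizers \<open>a\<close> may
  escape to infinity; therefore \<open>\<epsilon>\<close> is chosen after \<open>a\<close>, as \<open>\<delta> / (1 + \<parallel>a\<parallel>)\<close>. With this choice the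
  perturbation is at most \<open>\<delta> (1 + r)\<close> on the ball of radius \<open>r\<close> about the origin, wherever \<open>a\<close> is.
\<close>

lemma level_set_scalarized_le:
  assumes "\<xi> \<in> dual_cone C" and "x \<in> level_set C h y"
  shows "blinfun_apply \<xi> (h x) \<le> blinfun_apply \<xi> y"
  using assms by (auto simp: dual_cone_def level_set_def blinfun.diff_right)

text \<open>Monotonicity of \<open>\<xi>\<close> turns \<open>h x \<le>\<^sub>C h a\<close> into \<open>\<epsilon> \<parallel>x - a\<parallel> \<le> 0\<close>, so no other point is as good as \<open>a\<close>.\<close>

lemma sharp_minimum_imp_efficient:
  fixes h :: "'a::real_normed_vector \<Rightarrow> 'b::real_normed_vector"
  assumes \<xi>: "\<xi> \<in> dual_cone C" and "0 \<in> C" and "\<epsilon> > 0"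
    and sharp: "\<And>x. blinfun_apply \<xi> (h a) + \<epsilon> * norm (x - a) \<le> blinfun_apply \<xi> (h x)"
  shows "a \<in> efficient C h"
proof -
  have eq: "h x = h a" if below: "h x - h a \<in> uminus ` C" for x
  proof -
    obtain c where "c \<in> C" "h x - h a = - c" using below by blast
    then have "x \<in> level_set C h (h a)"
      by (auto simp: level_set_def image_iff intro!: bexI[of _ c] simp: algebra_simps)
    then have "\<epsilon> * norm (x - a) \<le> 0"
      using level_set_scalarized_le[OF \<xi>] sharp[of x] by fastforce
    then show ?thesis using \<open>\<epsilon> > 0\<close> by (simp add: mult_le_0_iff)
  qed
  have "(\<lambda>y. y - h a) ` range h \<inter> uminus ` C = {0}"
  proof (intro equalityI subsetI)
    fix y assume "y \<in> (\<lambda>y. y - h a) ` range h \<inter> uminus ` C"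
    then obtain x where "y = h x - h a" "h x - h a \<in> uminus ` C" by blast
    then show "y \<in> {0}" using eq by simp
  next
    fix y :: 'b assume "y \<in> {0}"
    moreover have "0 \<in> uminus ` C" by (rule image_eqI[of _ _ 0]) (use \<open>0 \<in> C\<close> in simp_all)
    moreover have "0 \<in> (\<lambda>y. y - h a) ` range h" by (rule image_eqI[of _ _ "h a"]) simp_all
    ultimately show "y \<in> (\<lambda>y. y - h a) ` range h \<inter> uminus ` C" by simp
  qed
  then show ?thesis by (simp add: efficient_def)
qed

lemma ediameter_le:
  assumes "\<And>x. x \<in> A \<Longrightarrow> norm (x - a) \<le> r"
  shows "ediameter A \<le> ennreal (2 * r)"
  unfolding ediameter_def
proof (rule SUP_least, clarify)
  fix x y assume "x \<in> A" "y \<in> A"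
  then have "norm (x - a) \<le> r" "norm (y - a) \<le> r" using assms by auto
  moreover have "norm (x - y) \<le> norm (x - a) + norm (y - a)"
    using norm_triangle_ineq4[of "x - a" "y - a"] by simp
  ultimately show "ennreal (norm (x - y)) \<le> ennreal (2 * r)" by (intro ennreal_leI) simp
qed

text \<open>The level set at \<open>h a + \<alpha> c\<close> lies in the ball about \<open>a\<close> of radius \<open>\<alpha> \<xi> c / \<epsilon>\<close>, which shrinks to
  zero with \<open>\<alpha>\<close>.\<close>

lemma sharp_minimum_imp_DH_well_posed:
  fixes h :: "'a::real_normed_vector \<Rightarrow> 'b::real_normed_vector"
  assumes \<xi>: "\<xi> \<in> dual_cone C" and "\<epsilon> > 0"
    and sharp: "\<And>x. blinfun_apply \<xi> (h a) + \<epsilon> * norm (x - a) \<le> blinfun_apply \<xi> (h x)"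
  shows "DH_well_posed_at C h a"
  unfolding DH_well_posed_at_def
proof
  fix c assume "c \<in> C"
  define s where "s = blinfun_apply \<xi> c"
  have "s \<ge> 0" using \<xi> \<open>c \<in> C\<close> by (simp add: s_def dual_cone_def)
  define d where "d \<alpha> = ediameter (level_set C h (h a + \<alpha> *\<^sub>R c))" for \<alpha>
  have d_le: "d \<alpha> \<le> ennreal (2 * (\<alpha> * s / \<epsilon>))" for \<alpha>
    unfolding d_def
  proof (rule ediameter_le)
    fix x assume "x \<in> level_set C h (h a + \<alpha> *\<^sub>R c)"
    from level_set_scalarized_le[OF \<xi> this] sharp[of x]
    have "\<epsilon> * norm (x - a) \<le> \<alpha> * s"
      by (simp add: s_def blinfun.add_right blinfun.scaleR_right)
    then show "norm (x - a) \<le> \<alpha> * s / \<epsilon>" using \<open>\<epsilon> > 0\<close> by (simp add: field_simps)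
  qed
  have bound: "(INF \<alpha>\<in>{0<..}. d \<alpha>) \<le> 0 + ennreal \<eta>" if "\<eta> > 0" for \<eta>
  proof (rule INF_lower2)
    (* the denominator s + 1 covers the case s = 0 *)
    let ?\<alpha> = "\<eta> * \<epsilon> / (2 * (s + 1))"
    show "?\<alpha> \<in> {0<..}" using that \<open>\<epsilon> > 0\<close> \<open>s \<ge> 0\<close> by simp
    have "2 * (?\<alpha> * s / \<epsilon>) = \<eta> * (s / (s + 1))"
      using \<open>\<epsilon> > 0\<close> \<open>s \<ge> 0\<close> by (simp add: divide_simps)
    also have "\<dots> \<le> \<eta>"
      by (rule mult_left_le) (use that \<open>s \<ge> 0\<close> in simp_all)
    finally have "2 * (?\<alpha> * s / \<epsilon>) \<le> \<eta>" .
    then show "d ?\<alpha> \<le> 0 + ennreal \<eta>"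
      using d_le[of ?\<alpha>] by (simp add: ennreal_leI order_trans)
  qed
  have "(INF \<alpha>\<in>{0<..}. d \<alpha>) \<le> 0" by (rule ennreal_le_epsilon) (rule bound)
  then show "(INF \<alpha>\<in>{0<..}. ediameter (level_set C h (h a + \<alpha> *\<^sub>R c))) = 0"
    by (simp add: d_def)
qed

lemma bounded_below_by_imp_bdd_below:
  assumes "bounded_below_by \<xi> f"
  shows "bdd_below (range (\<lambda>x. blinfun_apply \<xi> (f x)))"
proof -
  obtain m where "ereal m < (INF x. ereal (blinfun_apply \<xi> (f x)))"
    using assms ereal_dense2 unfolding bounded_below_by_def by blast
  then have "m \<le> blinfun_apply \<xi> (f x)" for x
    by (metis INF_lower UNIV_I ereal_less_eq(3) less_imp_le order_trans)
  then show ?thesis by (auto simp: bdd_below_def)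
qed

lemma exists_near_minimizer:
  fixes g :: "'a \<Rightarrow> real"
  assumes "bdd_below (range g)" and "\<delta> > 0"
  shows "\<exists>a. \<forall>x. g a - \<delta> \<le> g x"
proof -
  obtain a where a: "g a < (INF x. g x) + \<delta>"
    using \<open>\<delta> > 0\<close> cInf_lessD[of "range g" "(INF x. g x) + \<delta>"] by auto
  have "(INF x. g x) \<le> g x" for x using assms(1) by (simp add: cINF_lower)
  with a show ?thesis by (intro exI[of _ a] allI) (smt (verit))
qed

text \<open>The value lowered by \<open>\<delta>\<close> at the tip, which absorbs the defect of a \<open>\<delta>\<close>-minimizer, and a slope
  that decreases with the distance of the tip from the origin, so that a far tip does no harm on
  bounded sets.\<close>

definition cone_perturbation :: "real \<Rightarrow> 'a::real_normed_vector \<Rightarrow> 'a \<Rightarrow> real" where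
  "cone_perturbation \<delta> a x = (if x = a then - \<delta> else \<delta> / (1 + norm a) * norm (x - a))"

lemma cone_perturbation_sharp_minimum:
  assumes "\<And>x. g a - \<delta> \<le> g x"
  shows "g a + cone_perturbation \<delta> a a + \<delta> / (1 + norm a) * norm (x - a)
           \<le> g x + cone_perturbation \<delta> a x"
  using assms[of x] by (auto simp: cone_perturbation_def)

text \<open>The bound does not depend on the tip, because \<open>\<parallel>x - a\<parallel> \<le> r + \<parallel>a\<parallel> \<le> (1 + r) (1 + \<parallel>a\<parallel>)\<close>.\<close>

lemma abs_cone_perturbation_le:
  assumes "\<delta> \<ge> 0" and "norm x \<le> r"
  shows "\<bar>cone_perturbation \<delta> a x\<bar> \<le> \<delta> * (1 + r)"
proof -
  have "r \<ge> 0" using assms(2) norm_ge_zero order_trans by blast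
  have pos: "1 + norm a > 0" by (simp add: add_pos_nonneg)
  have "norm (x - a) \<le> r + norm a" using norm_triangle_ineq4[of x a] assms(2) by linarith
  also have "\<dots> \<le> (1 + r) * (1 + norm a)" using \<open>r \<ge> 0\<close> by (simp add: algebra_simps)
  finally have "norm (x - a) / (1 + norm a) \<le> 1 + r" using pos by (simp add: divide_le_eq)
  then have "\<delta> * (norm (x - a) / (1 + norm a)) \<le> \<delta> * (1 + r)"
    using \<open>\<delta> \<ge> 0\<close> by (rule mult_left_mono)
  moreover have "\<delta> \<le> \<delta> * (1 + r)" using \<open>r \<ge> 0\<close> \<open>\<delta> \<ge> 0\<close> by (simp add: algebra_simps)
  ultimately show ?thesis using \<open>\<delta> \<ge> 0\<close> pos by (auto simp: cone_perturbation_def)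
qed

theorem theorem4p4:
  fixes C :: "'b::banach set" and f :: "'a::banach \<Rightarrow> 'b"
  assumes "closed C" and "convex C" and "cone C"
    and pointed: "C \<inter> uminus ` C = {0}"
    and "interior C \<noteq> {}"
    and "\<exists>\<xi>\<in>dual_cone C - {0}.
           bounded_below_by \<xi> f \<and> lower_semicontinuous (\<lambda>x. blinfun_apply \<xi> (f x))"
  shows "\<exists>fn :: nat \<Rightarrow> 'a \<Rightarrow> 'b.
           (\<forall>B. bounded B \<longrightarrow> uniform_limit B fn f sequentially) \<and>
           (\<forall>n. efficient C (fn n) \<noteq> {} \<and>
                (\<exists>x\<in>efficient C (fn n). DH_well_posed_at C (fn n) x))"
proof -
  obtain \<xi> where \<xi>: "\<xi> \<in> dual_cone C" "\<xi> \<noteq> 0" and bdd: "bounded_below_by \<xi> f"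
    using assms(6) by auto
  define g where "g x = blinfun_apply \<xi> (f x)" for x
  have "0 \<in> C" using pointed by auto

  obtain u where u: "blinfun_apply \<xi> u \<noteq> 0" using \<open>\<xi> \<noteq> 0\<close> by (metis blinfun_eqI blinfun.zero_left)
  define e where "e = u /\<^sub>R blinfun_apply \<xi> u"
  have \<xi>e: "blinfun_apply \<xi> e = 1" using u by (simp add: e_def blinfun.scaleR_right)

  define \<delta> where "\<delta> n = 1 / real (Suc n)" for n
  have \<delta>: "\<delta> n > 0" for n by (simp add: \<delta>_def)
  have "bdd_below (range g)"
    unfolding g_def using bounded_below_by_imp_bdd_below[OF bdd] .
  then have "\<forall>n. \<exists>a. \<forall>x. g a - \<delta> n \<le> g x" using exists_near_minimizer \<delta> by blast
  from choice[OF this] obtain a where a: "\<And>n x. g (a n) - \<delta> n \<le> g x" by blast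

  define fn where "fn n x = f x + cone_perturbation (\<delta> n) (a n) x *\<^sub>R e" for n x
  have \<xi>fn: "blinfun_apply \<xi> (fn n x) = g x + cone_perturbation (\<delta> n) (a n) x" for n x
    by (simp add: fn_def g_def blinfun.add_right blinfun.scaleR_right \<xi>e)

  have "a n \<in> efficient C (fn n) \<and> DH_well_posed_at C (fn n) (a n)" for n
  proof -
    have slope: "\<delta> n / (1 + norm (a n)) > 0" using \<delta> by (simp add: add_pos_nonneg)
    have sharp: "blinfun_apply \<xi> (fn n (a n)) + \<delta> n / (1 + norm (a n)) * norm (x - a n)
        \<le> blinfun_apply \<xi> (fn n x)" for x
      unfolding \<xi>fn using cone_perturbation_sharp_minimum[of g, OF a] .
    show ?thesis
      using sharp_minimum_imp_efficient[OF \<xi>(1) \<open>0 \<in> C\<close> slope sharp]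
        sharp_minimum_imp_DH_well_posed[OF \<xi>(1) slope sharp] by blast
  qed
  moreover have "uniform_limit B fn f sequentially" if B: "bounded B" for B
  proof -
    obtain r where r: "\<And>x. x \<in> B \<Longrightarrow> norm x \<le> r" using B by (auto simp: bounded_iff)
    have lim: "(\<lambda>n. \<delta> n * ((1 + r) * norm e)) \<longlonglongrightarrow> 0"
      unfolding \<delta>_def using tendsto_mult_left_zero[OF LIMSEQ_Suc[OF lim_1_over_n]] by simp
    have dist_le: "dist (fn n x) (f x) \<le> \<delta> n * ((1 + r) * norm e)" if "x \<in> B" for n x
      using mult_right_mono[OF abs_cone_perturbation_le[of "\<delta> n", OF less_imp_le[OF \<delta>] r[OF that]]
          norm_ge_zero[of e]]
      by (simp add: fn_def dist_norm mult.assoc)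
    show ?thesis
    proof (rule uniform_limitI)
      fix \<eta> :: real assume "\<eta> > 0"
      from order_tendstoD(2)[OF lim this]
      show "\<forall>\<^sub>F n in sequentially. \<forall>x\<in>B. dist (fn n x) (f x) < \<eta>"
        by (rule eventually_mono) (blast intro: le_less_trans dist_le)
    qed
  qed
  ultimately show ?thesis by blast
qed

end
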